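(* An infinite para-tridiagonal matrix is unitary if and only if it has the form $C(\mathbf a,\mathbf b)$ for some sequences $\mathbf a=(a_n)_{n\in\mathbb N},\mathbf b=(b_n)_{n\in\mathbb N}$ of complex numbers with $|a_n|^2+|b_n|^2=1$ for all $n\in\mathbb N$. An infinite Hessenberg matrix is isometric if and only if it has the form $H(\mathbf a,\mathbf b)$ for some sequences $\mathbf a,\mathbf b$ of complex numbers with $|a_n|^2+|b_n|^2=1$ for all $n\in\mathbb N$.
   Context: Infinite matrices are complex, indexed by $\mathbb{N}=\{1,2,\dots\}$, and (if bounded) identified with operators on $\ell^2(\mathbb N)$ with respect to the canonical basis. A matrix $M$ is isometric if $M^*M=I$, unitary if $M^*M=MM^*=I$. A Hessenberg matrix $(h_{i,j})$ satisfies $h_{i,j}=0$ for $i>j+1$. A para-tridiagonal matrix is a five-diagonal matrix $(c_{i,j})$ ($c_{i,j}=0$ for $|i-j|>2$) with $c_{2k,2k+2}=c_{2k+1,2k-1}=0$ for all $k\ge1$. For sequences $\mathbf a,\mathbf b$ put $a_0=1$. $C(\mathbf a,\mathbf b)$ is the matrix whose only possibly nonzero entries are, for $k\ge0$ (entries with column index $0$ being omitted): row $2k+1$: $c_{2k+1,2k}=-\overline b_{2k}a_{2k+1}$, $c_{2k+1,2k+1}=-\overline a_{2k}a_{2k+1}$, $c_{2k+1,2k+2}=-\overline b_{2k+1}a_{2k+2}$, $c_{2k+1,2k+3}=\overline b_{2k+1}b_{2k+2}$; row $2k+2$: $c_{2k+2,2k}=\overline b_{2k}b_{2k+1}$, $c_{2k+2,2k+1}=\overline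 a_{2k}b_{2k+1}$, $c_{2k+2,2k+2}=-\overline a_{2k+1}a_{2k+2}$, $c_{2k+2,2k+3}=\overline a_{2k+1}b_{2k+2}$. $H(\mathbf a,\mathbf b)=(h_{i,j})$ is given by $h_{j+1,j}=b_j$, $h_{i,j}=-\overline a_{i-1}\,\overline b_i\,\overline b_{i+1}\cdots\overline b_{j-1}\,a_j$ for $1\le i\le j$ (empty product of $b$'s equal to $1$ when $i=j$), and $h_{i,j}=0$ for $i>j+1$. *)

theory Defs
  imports "HOL-Analysis.Analysis"
begin

text \<open>Matrices and sequences are indexed by the positive integers. They are represented by functions
  on \<open>nat\<close> whose values at index 0 are irrelevant: every notion below only inspects positive indices.\<close>

type_synonym inf_matrix = "nat \<Rightarrow> nat \<Rightarrow> complex"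

definition mat_eq :: "inf_matrix \<Rightarrow> inf_matrix \<Rightarrow> bool" where
  "mat_eq M N \<longleftrightarrow> (\<forall>i\<ge>1. \<forall>j\<ge>1. M i j = N i j)"

text \<open>The relation \<open>is_mat_prod A B P\<close> says that the series defining the entries of the product \<open>A B\<close>
  converge (absolutely, since summation is unordered) and that \<open>A B = P\<close>.\<close>

definition is_mat_prod :: "inf_matrix \<Rightarrow> inf_matrix \<Rightarrow> inf_matrix \<Rightarrow> bool" where
  "is_mat_prod A B P \<longleftrightarrow> (\<forall>i\<ge>1. \<forall>j\<ge>1. ((\<lambda>k. A i k * B k j) has_sum P i j) {1..})"

definition mat_adjoint :: "inf_matrix \<Rightarrow> inf_matrix" where
  "mat_adjoint M = (\<lambda>i j. cnj (M j i))"

definition mat_id :: inf_matrix where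
  "mat_id = (\<lambda>i j. if i = j then 1 else 0)"

text \<open>Boundedness on \<open>\<ell>\<^sup>2\<close> need not be required separately: \<open>M\<^sup>* M = I\<close> makes the columns
  of \<open>M\<close> orthonormal in \<open>\<ell>\<^sup>2\<close>, so that \<open>M\<close> is the matrix of an isometry.\<close>

definition isometric_matrix :: "inf_matrix \<Rightarrow> bool" where
  "isometric_matrix M \<longleftrightarrow> is_mat_prod (mat_adjoint M) M mat_id"

definition unitary_matrix :: "inf_matrix \<Rightarrow> bool" where
  "unitary_matrix M \<longleftrightarrow>
     is_mat_prod (mat_adjoint M) M mat_id \<and> is_mat_prod M (mat_adjoint M) mat_id"

definition hessenberg :: "inf_matrix \<Rightarrow> bool" where
  "hessenberg M \<longleftrightarrow> (\<forall>i\<ge>1. \<forall>j\<ge>1. i > j + 1 \<longrightarrow> M i j = 0)"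

definition para_tridiagonal :: "inf_matrix \<Rightarrow> bool" where
  "para_tridiagonal M \<longleftrightarrow>
     (\<forall>i\<ge>1. \<forall>j\<ge>1. \<bar>int i - int j\<bar> > 2 \<longrightarrow> M i j = 0) \<and>
     (\<forall>k\<ge>1. M (2*k) (2*k+2) = 0 \<and> M (2*k+1) (2*k-1) = 0)"

text \<open>The update \<open>a(0 := 1)\<close> implements the convention \<open>a\<^sub>0 = 1\<close>. A row index \<open>i \<ge> 1\<close> is
  \<open>2k+1\<close> or \<open>2k+2\<close> with \<open>k = (i - 1) div 2\<close>. For \<open>k = 0\<close> the column \<open>2k\<close>, and with it
  the value of \<open>b\<close> at 0, lies outside the index set.\<close>

definition C_matrix :: "(nat \<Rightarrow> complex) \<Rightarrow> (nat \<Rightarrow> complex) \<Rightarrow> inf_matrix" where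
  "C_matrix a b = (\<lambda>i j. let \<alpha> = a(0 := 1); k = (i - 1) div 2 in
     if i = 2*k+1 then
       (if j = 2*k then - cnj (b (2*k)) * \<alpha> (2*k+1)
        else if j = 2*k+1 then - cnj (\<alpha> (2*k)) * \<alpha> (2*k+1)
        else if j = 2*k+2 then - cnj (b (2*k+1)) * \<alpha> (2*k+2)
        else if j = 2*k+3 then cnj (b (2*k+1)) * b (2*k+2)
        else 0)
     else
       (if j = 2*k then cnj (b (2*k)) * b (2*k+1)
        else if j = 2*k+1 then cnj (\<alpha> (2*k)) * b (2*k+1)
        else if j = 2*k+2 then - cnj (\<alpha> (2*k+1)) * \<alpha> (2*k+2)
        else if j = 2*k+3 then cnj (\<alpha> (2*k+1)) * b (2*k+2)
        else 0))"

definition H_matrix :: "(nat \<Rightarrow> complex) \<Rightarrow> (nat \<Rightarrow> complex) \<Rightarrow> inf_matrix" where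
  "H_matrix a b = (\<lambda>i j. let \<alpha> = a(0 := 1) in
     if i = j + 1 then b j
     else if i \<le> j then - cnj (\<alpha> (i - 1)) * (\<Prod>l=i..<j. cnj (b l)) * \<alpha> j
     else 0)"

end

theory Submission
  imports Defs
begin

text \<open>
  Hessenberg part: let \<open>w\<^sub>1 = e\<^sub>1\<close> and \<open>w\<^sub>j\<^sub>+\<^sub>1 = cnj b\<^sub>j w\<^sub>j + cnj a\<^sub>j e\<^sub>j\<^sub>+\<^sub>1\<close>. The columns of
  \<open>H(a, b)\<close> are \<open>- a\<^sub>j w\<^sub>j + b\<^sub>j e\<^sub>j\<^sub>+\<^sub>1\<close>, so each step applies a unitary \<open>2 \<times> 2\<close> matrix to the pair
  \<open>w\<^sub>j, e\<^sub>j\<^sub>+\<^sub>1\<close>. Hence the first \<open>j - 1\<close> columns together with \<open>w\<^sub>j\<close> form an orthonormal basis of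
  the span of \<open>e\<^sub>1, \<dots>, e\<^sub>j\<close>, and a next orthonormal column is forced to lie in the span of \<open>w\<^sub>j\<close> and
  \<open>e\<^sub>j\<^sub>+\<^sub>1\<close>.

  Para-tridiagonal part: the staircase shape cuts the matrix into \<open>2 \<times> 2\<close> blocks \<open>X\<^sub>0, X\<^sub>1, \<dots>\<close>, where
  those with odd index are transposed. Unitarity says that \<open>X\<^sub>n X\<^sub>n\<^sup>* + cnj (X\<^sub>n\<^sub>+\<^sub>1\<^sup>* X\<^sub>n\<^sub>+\<^sub>1) = I\<close> and
  \<open>X\<^sub>n\<^sub>+\<^sub>1 cnj X\<^sub>n = 0\<close>. Since the column of index 0 is missing, \<open>X\<^sub>0\<close> has rank one; the first relation
  propagates this, and \<open>X\<^sub>n\<close> is the outer product of \<open>(- a\<^sub>n\<^sub>+\<^sub>1, b\<^sub>n\<^sub>+\<^sub>1)\<close> and \<open>(cnj b\<^sub>n, cnj a\<^sub>n)\<close>.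
\<close>

subsection \<open>Isometric Hessenberg matrices\<close>

text \<open>Coordinate \<open>i\<close> of the vector w_j from the overview: the product solves its
  recursion, and \<open>a(0 := 1)\<close> makes w_1 = e_1.\<close>

definition defect :: "(nat \<Rightarrow> complex) \<Rightarrow> (nat \<Rightarrow> complex) \<Rightarrow> nat \<Rightarrow> nat \<Rightarrow> complex" where
  "defect a b j i = (if i \<le> j then cnj ((a(0 := 1)) (i - 1)) * (\<Prod>l=i..<j. cnj (b l)) else 0)"

lemma defect_one: "i \<ge> 1 \<Longrightarrow> defect a b 1 i = (if i = 1 then 1 else 0)"
  by (auto simp: defect_def)

lemma defect_Suc:
  assumes "j \<ge> 1"
  shows "defect a b (Suc j) i = cnj (b j) * defect a b j i + (if i = Suc j then cnj (a j) else 0)"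
  using assms by (auto simp: defect_def le_Suc_eq mult_ac)

lemma defect_eq_0: "j < i \<Longrightarrow> defect a b j i = 0"
  by (simp add: defect_def)

lemma H_matrix_defect:
  assumes "j \<ge> 1"
  shows "H_matrix a b i j = - a j * defect a b j i + (if i = Suc j then b j else 0)"
  using assms by (auto simp: H_matrix_def defect_def Let_def)

lemma hessenberg_H_matrix: "hessenberg (H_matrix a b)"
  by (auto simp: hessenberg_def H_matrix_def Let_def)

lemma unit_pair_complex:
  "(cmod x)\<^sup>2 + (cmod y)\<^sup>2 = 1 \<longleftrightarrow> x * cnj x + y * cnj y = 1"
  by (metis complex_norm_square of_real_add of_real_eq_1_iff)

text \<open>The two summands of w_{j+1} have disjoint supports, so its squared norm is |b_j|^2 times
  that of w_j, plus |a_j|^2. Assuming only \<open>m < j\<close> keeps this usable while the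
  parameters are still being verified inductively.\<close>

lemma defect_norm:
  assumes "\<And>m. 1 \<le> m \<Longrightarrow> m < j \<Longrightarrow> a m * cnj (a m) + b m * cnj (b m) = 1" and "j \<ge> 1"
  shows "(\<Sum>i=1..j. defect a b j i * cnj (defect a b j i)) = 1"
  using assms(2,1)
proof (induction j rule: dec_induct)
  case base
  show ?case by (simp add: defect_one[simplified])
next
  case (step j)
  have "(\<Sum>i=1..Suc j. defect a b (Suc j) i * cnj (defect a b (Suc j) i))
      = (\<Sum>i=1..j. defect a b (Suc j) i * cnj (defect a b (Suc j) i)) + a j * cnj (a j)"
    using step.hyps by (simp add: defect_Suc defect_eq_0 mult.commute)
  also have "(\<Sum>i=1..j. defect a b (Suc j) i * cnj (defect a b (Suc j) i))
      = (\<Sum>i=1..j. (b j * cnj (b j)) * (defect a b j i * cnj (defect a b j i)))"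
    using step.hyps by (intro sum.cong) (auto simp: defect_Suc mult_ac)
  also have "\<dots> = b j * cnj (b j)"
    using step by (simp flip: sum_distrib_left)
  finally show ?case using step.prems[of j] step.hyps by (simp add: add.commute)
qed

text \<open>The 2 x 2 step is unitary, so replacing w_j, e_{j+1} by column j and w_{j+1} preserves
  the sum of the two rank-one projections. This completeness relation later expands an unknown
  column.\<close>

lemma defect_resolution:
  assumes "\<And>m. 1 \<le> m \<Longrightarrow> m < j \<Longrightarrow> a m * cnj (a m) + b m * cnj (b m) = 1" and "j \<ge> 1"
    and "1 \<le> i" "i \<le> j" "1 \<le> i'" "i' \<le> j"
  shows "(\<Sum>m=1..<j. H_matrix a b i m * cnj (H_matrix a b i' m))
           + defect a b j i * cnj (defect a b j i') = (if i = i' then 1 else 0)"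
  using assms(2,1,3-)
proof (induction j arbitrary: i i' rule: dec_induct)
  case base
  then show ?case by (simp add: defect_one[simplified])
next
  case (step j)
  let ?w = "defect a b j" and ?e = "\<lambda>i. if i = Suc j then 1 else (0::complex)"
  have u: "a j * cnj (a j) + b j * cnj (b j) = 1"
    using step by simp
  have "H_matrix a b i j * cnj (H_matrix a b i' j)
      + defect a b (Suc j) i * cnj (defect a b (Suc j) i')
      = (- a j * ?w i + b j * ?e i) * cnj (- a j * ?w i' + b j * ?e i')
      + (cnj (b j) * ?w i + cnj (a j) * ?e i) * cnj (cnj (b j) * ?w i' + cnj (a j) * ?e i')"
    using step.hyps by (simp add: H_matrix_defect defect_Suc)
  also have "\<dots> = (a j * cnj (a j) + b j * cnj (b j)) * (?w i * cnj (?w i') + ?e i * ?e i')"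
    by (simp add: algebra_simps)
  finally have *: "H_matrix a b i j * cnj (H_matrix a b i' j)
      + defect a b (Suc j) i * cnj (defect a b (Suc j) i') = ?w i * cnj (?w i') + ?e i * ?e i'"
    using u by simp
  have h0: "H_matrix a b (Suc j) m = 0" if "m \<in> {1..<j}" for m
    using that by (auto simp: H_matrix_def Let_def)
  have **: "(\<Sum>m=1..<Suc j. H_matrix a b i m * cnj (H_matrix a b i' m))
           + defect a b (Suc j) i * cnj (defect a b (Suc j) i')
     = (\<Sum>m=1..<j. H_matrix a b i m * cnj (H_matrix a b i' m)) + ?w i * cnj (?w i') + ?e i * ?e i'"
    using * step.hyps by (simp add: add.assoc)
  show ?case
  proof (cases "i = Suc j \<or> i' = Suc j")
    case True
    then show ?thesis unfolding ** using h0 by (auto simp: defect_eq_0 intro!: sum.neutral)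
  next
    case False
    then show ?thesis unfolding ** using step.IH[of i i'] step.prems by simp
  qed
qed

text \<open>Columns before j vanish at row j + 1 and are already orthogonal to w_j. For column j the
  contributions of w_j and e_{j+1} to the inner product with w_{j+1} cancel.\<close>

lemma defect_orthogonal:
  assumes "\<And>m. 1 \<le> m \<Longrightarrow> m < j \<Longrightarrow> a m * cnj (a m) + b m * cnj (b m) = 1" and "j \<ge> 1"
    and "1 \<le> m" "m < j"
  shows "(\<Sum>i=1..j. cnj (H_matrix a b i m) * defect a b j i) = 0"
  using assms(2,1,3-)
proof (induction j rule: dec_induct)
  case base
  then show ?case by simp
next
  case (step j)
  have "(\<Sum>i=1..Suc j. cnj (H_matrix a b i m) * defect a b (Suc j) i)
      = (\<Sum>i=1..j. cnj (H_matrix a b i m) * defect a b (Suc j) i)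
        + cnj (H_matrix a b (Suc j) m) * cnj (a j)"
    using step.hyps by (simp add: defect_Suc defect_eq_0)
  also have "(\<Sum>i=1..j. cnj (H_matrix a b i m) * defect a b (Suc j) i)
      = cnj (b j) * (\<Sum>i=1..j. cnj (H_matrix a b i m) * defect a b j i)"
    unfolding sum_distrib_left
    using step.hyps by (intro sum.cong) (auto simp: defect_Suc mult_ac)
  finally have *: "(\<Sum>i=1..Suc j. cnj (H_matrix a b i m) * defect a b (Suc j) i)
      = cnj (b j) * (\<Sum>i=1..j. cnj (H_matrix a b i m) * defect a b j i)
        + cnj (H_matrix a b (Suc j) m) * cnj (a j)" .
  show ?case
  proof (cases "m = j")
    case False
    then have "H_matrix a b (Suc j) m = 0"
      using step.prems by (auto simp: H_matrix_def Let_def)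
    then show ?thesis using * step False by simp
  next
    case True
    have "(\<Sum>i=1..j. cnj (H_matrix a b i j) * defect a b j i)
        = - cnj (a j) * (\<Sum>i=1..j. defect a b j i * cnj (defect a b j i))"
      unfolding sum_distrib_left
      using step.hyps by (intro sum.cong) (auto simp: H_matrix_defect mult_ac)
    also have "\<dots> = - cnj (a j)"
      using defect_norm[of j a b] step by simp
    finally show ?thesis
      using * True step.hyps by (simp add: H_matrix_defect defect_eq_0)
  qed
qed

section \<open>Orthonormality of Hessenberg columns as finite sums, and the characterization of the
  isometric ones\<close>

lemma has_sum_atLeast_1_iff:
  fixes f :: "nat \<Rightarrow> complex"
  assumes "\<And>k. k \<ge> 1 \<Longrightarrow> k \<notin> F \<Longrightarrow> f k = 0" "finite F" "F \<subseteq> {1..}"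
  shows "(f has_sum S) {1..} \<longleftrightarrow> S = sum f F"
proof -
  have "(f has_sum S) {1..} \<longleftrightarrow> (f has_sum S) F"
    using assms by (intro has_sum_cong_neutral) auto
  then show ?thesis
    using assms(2) by (metis has_sum_finite has_sum_unique)
qed

text \<open>Column \<open>i\<close> ends at row \<open>Suc i\<close>, so its inner products are
  finite; conjugate symmetry leaves only \<open>i \<le> j\<close> to check.\<close>

lemma hessenberg_isometric_iff:
  assumes "hessenberg M"
  shows "isometric_matrix M \<longleftrightarrow>
    (\<forall>i\<ge>1. \<forall>j\<ge>i. (\<Sum>k=1..Suc i. cnj (M k i) * M k j) = (if i = j then 1 else 0))"
    (is "_ \<longleftrightarrow> ?R")
proof -
  have eq: "((\<lambda>k. cnj (M k i) * M k j) has_sum S) {1..} \<longleftrightarrow> S = (\<Sum>k=1..Suc i. cnj (M k i) * M k j)"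
    if "i \<ge> 1" for i j S
    using that assms by (intro has_sum_atLeast_1_iff) (auto simp: hessenberg_def)
  show ?thesis
  proof
    assume "isometric_matrix M"
    then show ?R
      using eq by (auto simp: isometric_matrix_def is_mat_prod_def mat_adjoint_def mat_id_def)
  next
    assume R: ?R
    have "((\<lambda>k. cnj (M k i) * M k j) has_sum mat_id i j) {1..}" if "i \<ge> 1" "j \<ge> 1" for i j
    proof (cases "i \<le> j")
      case True
      then show ?thesis using R that eq by (simp add: mat_id_def)
    next
      case False
      then have "((\<lambda>k. cnj (M k j) * M k i) has_sum 0) {1..}"
        using R that eq by simp
      then have "((\<lambda>k. cnj (cnj (M k j) * M k i)) has_sum cnj 0) {1..}"
        by (simp only: has_sum_cnj_iff)
      then show ?thesis using False by (simp add: mat_id_def mult.commute)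
    qed
    then show "isometric_matrix M"
      by (simp add: isometric_matrix_def is_mat_prod_def mat_adjoint_def)
  qed
qed

text \<open>On the first \<open>j\<close> rows column \<open>j\<close> is a multiple of w_j. An
  earlier column lives on these rows and is orthogonal to w_j.\<close>

lemma H_matrix_isometric:
  assumes u: "\<And>n. n \<ge> 1 \<Longrightarrow> a n * cnj (a n) + b n * cnj (b n) = 1"
  shows "isometric_matrix (H_matrix a b)"
  unfolding hessenberg_isometric_iff[OF hessenberg_H_matrix]
proof (intro allI impI)
  fix i j :: nat
  assume i: "1 \<le> i" and j: "i \<le> j"
  have *: "(\<Sum>k=1..j. cnj (H_matrix a b k i) * H_matrix a b k j)
      = - a j * (\<Sum>k=1..j. cnj (H_matrix a b k i) * defect a b j k)"
    unfolding sum_distrib_left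
    using i j by (intro sum.cong) (auto simp: H_matrix_defect)
  show "(\<Sum>k=1..Suc i. cnj (H_matrix a b k i) * H_matrix a b k j) = (if i = j then 1 else 0)"
  proof (cases "i = j")
    case True
    have "(\<Sum>k=1..j. cnj (H_matrix a b k j) * defect a b j k)
        = - cnj (a j) * (\<Sum>i=1..j. defect a b j i * cnj (defect a b j i))"
      unfolding sum_distrib_left
      using i j by (intro sum.cong) (auto simp: H_matrix_defect mult_ac)
    also have "\<dots> = - cnj (a j)"
      using defect_norm[of j a b] u i j by simp
    finally show ?thesis
      using * True u[of j] i by (simp add: H_matrix_defect defect_eq_0 mult.commute)
  next
    case False
    have "(\<Sum>k=1..Suc i. cnj (H_matrix a b k i) * H_matrix a b k j)
        = (\<Sum>k=1..j. cnj (H_matrix a b k i) * H_matrix a b k j)"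
      using False j i
      by (intro sum.mono_neutral_left) (auto simp: H_matrix_def Let_def)
    also have "\<dots> = 0"
      using * defect_orthogonal[of j a b i] u i j False by simp
    finally show ?thesis using False by simp
  qed
qed

text \<open>Expresses \<^const>\<open>defect\<close> through the entries of the matrix alone, which breaks the mutual
  recursion between the vectors \<open>w\<^sub>j\<close> and the parameters \<open>a\<^sub>j\<close>.\<close>

primrec defect_of :: "inf_matrix \<Rightarrow> nat \<Rightarrow> nat \<Rightarrow> complex" where
  "defect_of M 0 = (\<lambda>i. 0)"
| "defect_of M (Suc j) = (\<lambda>i. if j = 0 then (if i = 1 then 1 else 0)
     else cnj (M (Suc j) j) * defect_of M j i
       + (if i = Suc j then - (\<Sum>k=1..j. defect_of M j k * cnj (M k j)) else 0))"

lemma isometric_hessenberg_imp_H_matrix: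
  assumes h: "hessenberg M" and iso: "isometric_matrix M"
  obtains a b where "\<And>n. n \<ge> 1 \<Longrightarrow> a n * cnj (a n) + b n * cnj (b n) = 1" "mat_eq M (H_matrix a b)"
proof -
  \<comment> \<open>These values are forced: if column j is - a_j w_j + b_j e_{j+1} with w_j a unit
    vector, its inner product with w_j is - a_j.\<close>
  define a where "a j = - (\<Sum>k=1..j. cnj (defect_of M j k) * M k j)" for j
  define b where "b j = M (Suc j) j" for j
  have w: "defect_of M j i = defect a b j i" if "j \<ge> 1" "i \<ge> 1" for i j
    using that(1)
  proof (induction j rule: dec_induct)
    case base
    then show ?case using that by (simp add: defect_one[simplified])
  next
    case (step j)
    have "cnj (a j) = - (\<Sum>k=1..j. defect_of M j k * cnj (M k j))"
      by (simp add: a_def)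
    then show ?case
      using defect_Suc[of j a b i] step by (simp add: b_def[symmetric])
  qed
  have orth: "(\<Sum>k=1..Suc i. cnj (M k i) * M k j) = (if i = j then 1 else 0)"
    if "1 \<le> i" "i \<le> j" for i j
    using iso that by (simp add: hessenberg_isometric_iff[OF h])
  have main: "a j * cnj (a j) + b j * cnj (b j) = 1 \<and> (\<forall>i\<ge>1. M i j = H_matrix a b i j)"
    if "j \<ge> 1" for j
    using that
  proof (induction j rule: less_induct)
    case (less j)
    have u: "a m * cnj (a m) + b m * cnj (b m) = 1" if "1 \<le> m" "m < j" for m
      using less.IH that by simp
    have col: "M i m = H_matrix a b i m" if "1 \<le> m" "m < j" "1 \<le> i" for i m
      using less.IH that by simp
    let ?w = "defect a b j"
    have aw: "(\<Sum>k=1..j. cnj (?w k) * M k j) = - a j"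
      using less.prems w by (simp add: a_def)
    have top: "M i j = - a j * ?w i" if i: "i \<ge> 1" "i \<le> j" for i
    proof -
      \<comment> \<open>Column \<open>m\<close> ends at row \<open>m + 1 \<le> j\<close>, so cutting
        the sum at \<open>j\<close> loses nothing.\<close>
      have z: "(\<Sum>k=1..j. cnj (M k m) * M k j) = 0" if "m \<in> {1..<j}" for m
      proof -
        have "(\<Sum>k=1..Suc m. cnj (M k m) * M k j) = (\<Sum>k=1..j. cnj (M k m) * M k j)"
          using that h by (intro sum.mono_neutral_left) (auto simp: hessenberg_def)
        then show ?thesis using orth[of m j] that by simp
      qed
      \<comment> \<open>Insert the completeness relation for the earlier columns and w_j.
        Orthogonality to those columns leaves only the w_j term.\<close>
      have "M i j = (\<Sum>k=1..j. (if i = k then 1 else 0) * M k j)"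
        using i by (simp add: if_distrib[of "\<lambda>x. x * _"] cong: if_cong)
      also have "\<dots> = (\<Sum>k=1..j. ((\<Sum>m=1..<j. M i m * cnj (M k m)) + ?w i * cnj (?w k)) * M k j)"
      proof (intro sum.cong refl)
        fix k assume "k \<in> {1..j}"
        then have k: "1 \<le> k" "k \<le> j" by auto
        have "(\<Sum>m=1..<j. M i m * cnj (M k m)) = (\<Sum>m=1..<j. H_matrix a b i m * cnj (H_matrix a b k m))"
          using col i k by (intro sum.cong) auto
        then show "(if i = k then 1 else 0) * M k j
            = ((\<Sum>m=1..<j. M i m * cnj (M k m)) + ?w i * cnj (?w k)) * M k j"
          using defect_resolution[of j a b i k] u less.prems i k by simp
      qed
      also have "\<dots> = (\<Sum>k=1..j. \<Sum>m=1..<j. M i m * (cnj (M k m) * M k j))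
            + ?w i * (\<Sum>k=1..j. cnj (?w k) * M k j)"
        by (simp add: distrib_right sum.distrib sum_distrib_left sum_distrib_right mult.assoc)
      also have "(\<Sum>k=1..j. \<Sum>m=1..<j. M i m * (cnj (M k m) * M k j))
          = (\<Sum>m=1..<j. M i m * (\<Sum>k=1..j. cnj (M k m) * M k j))"
        by (subst sum.swap) (simp add: sum_distrib_left)
      also have "\<dots> = 0" using z by simp
      finally show ?thesis using aw by simp
    qed
    have "1 = (\<Sum>k=1..Suc j. cnj (M k j) * M k j)"
      using orth[of j j] less.prems by simp
    also have "\<dots> = (\<Sum>k=1..j. cnj (M k j) * M k j) + b j * cnj (b j)"
      by (simp add: b_def mult.commute)
    also have "(\<Sum>k=1..j. cnj (M k j) * M k j) = (\<Sum>k=1..j. (a j * cnj (a j)) * (?w k * cnj (?w k)))"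
      using top by (intro sum.cong) (auto simp: mult_ac)
    also have "\<dots> = a j * cnj (a j)"
      using defect_norm[of j a b] u less.prems by (simp flip: sum_distrib_left)
    finally have 1: "a j * cnj (a j) + b j * cnj (b j) = 1" by simp
    have "M i j = H_matrix a b i j" if "i \<ge> 1" for i
    proof -
      consider "i \<le> j" | "i = Suc j" | "i > Suc j" by linarith
      then show ?thesis
        using top[of i] less.prems that h
        by cases (auto simp: H_matrix_defect defect_eq_0 b_def hessenberg_def)
    qed
    with 1 show ?case by blast
  qed
  show thesis
    by (rule that[of a b]) (use main in \<open>auto simp: mat_eq_def\<close>)
qed

subsection \<open>Unitary para-tridiagonal matrices\<close>

text \<open>A line of index \<open>p\<close> is a row for even \<open>p\<close> and a column for odd \<open>p\<close>. With this convention the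
  lines \<open>n + 1\<close> and \<open>n + 2\<close> of index \<open>n\<close> are supported on the positions \<open>n, \<dots>, n + 3\<close>, so that rows and
  columns are treated by one argument.\<close>

definition line_entry :: "inf_matrix \<Rightarrow> nat \<Rightarrow> nat \<Rightarrow> nat \<Rightarrow> complex" where
  "line_entry M p i l = (if i = 0 \<or> l = 0 then 0 else if even p then M i l else M l i)"

text \<open>The block X_n: the first half of the support of the lines \<open>n + 1\<close> and
  \<open>n + 2\<close>.\<close>

definition block :: "inf_matrix \<Rightarrow> nat \<Rightarrow> nat \<Rightarrow> nat \<Rightarrow> complex" where
  "block M n s t = line_entry M n (n + 1 + s) (n + t)"

text \<open>Changing the parity exchanges rows and columns, so the second half of these two lines is
  the transpose of X_{n+1}.\<close>

lemma block_Suc: "block M (Suc n) t s = line_entry M n (n + 1 + s) (n + 2 + t)"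
  by (auto simp: block_def line_entry_def)

text \<open>The band alone would still allow position \<open>n - 1\<close> on line
  \<open>n + 1\<close> and \<open>n + 4\<close> on line \<open>n + 2\<close>. The two extra zero
  conditions remove exactly these.\<close>

lemma para_tridiagonal_line_eq_0:
  assumes M: "para_tridiagonal M" and s: "s < 2" and l: "l < n \<or> n + 3 < l"
  shows "line_entry M n (n + 1 + s) l = 0"
proof (cases "l = 0")
  case True
  then show ?thesis by (simp add: line_entry_def)
next
  case False
  have band: "M i j = 0" if "i \<ge> 1" "j \<ge> 1" "\<bar>int i - int j\<bar> > 2" for i j
    using M that by (simp add: para_tridiagonal_def)
  have even0: "M (2*k) (2*k+2) = 0" and odd0: "M (2*k+1) (2*k-1) = 0" if "k \<ge> 1" for k
    using M that by (simp_all add: para_tridiagonal_def)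
  consider "l + 2 < n + 1 + s \<or> n + 1 + s + 2 < l" | "l + 2 = n + 1 + s" "s = 0" "n = l + 1"
    | "l = n + 1 + s + 2" "s = 1" "l = n + 4"
    using s l by linarith
  then show ?thesis
  proof cases
    case 1
    then show ?thesis using False band by (auto simp: line_entry_def)
  next
    case 2
    show ?thesis
    proof (cases "even n")
      case True
      then obtain k where "n = 2 * k" by blast
      moreover from this 2 have "l = 2 * k - 1" by linarith
      ultimately show ?thesis using odd0[of k] 2 False by (auto simp: line_entry_def)
    next
      case odd: False
      then obtain k where "n = 2 * k + 1" by (elim oddE)
      then show ?thesis using even0[of k] 2 False by (auto simp: line_entry_def)
    qed
  next
    case 3
    show ?thesis
    proof (cases "even n")
      case True
      then obtain k where "n = 2 * k" by blast
      with 3 have idx: "n + 1 + s = 2 * (k + 1)" "l = 2 * (k + 1) + 2" by simp_all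
      show ?thesis
        using even0[of "k+1"] True unfolding line_entry_def idx by simp
    next
      case odd: False
      then obtain k where "n = 2 * k + 1" by (elim oddE)
      with 3 have idx: "n + 1 + s = 2 * (k + 2) - 1" "l = 2 * (k + 2) + 1" by simp_all
      show ?thesis
        using odd0[of "k+2"] odd unfolding line_entry_def idx by simp
    qed
  qed
qed

section \<open>Unitarity in terms of the blocks\<close>

lemma line_has_sum_iff:
  assumes M: "para_tridiagonal M" and s: "s < 2"
  shows "((\<lambda>l. line_entry M n (n + 1 + s) l * cnj (line_entry M n j l)) has_sum S) {1..} \<longleftrightarrow>
     S = block M n s 0 * cnj (line_entry M n j n) + block M n s 1 * cnj (line_entry M n j (n + 1))
       + block M (Suc n) 0 s * cnj (line_entry M n j (n + 2))
       + block M (Suc n) 1 s * cnj (line_entry M n j (n + 3))"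
    (is "(?f has_sum S) _ \<longleftrightarrow> _")
proof -
  have "(?f has_sum S) {1..} \<longleftrightarrow> S = sum ?f ({n..n+3} - {0})"
    using para_tridiagonal_line_eq_0[OF assms]
    by (intro has_sum_atLeast_1_iff) (force simp: not_le)+
  \<comment> \<open>For \<open>n = 0\<close> position 0 is outside the index set, but
    \<open>line_entry\<close> vanishes there, so one four-term formula serves every
    \<open>n\<close>.\<close>
  also have "sum ?f ({n..n+3} - {0}) = sum ?f {n..n+3}"
    by (intro sum.mono_neutral_left) (auto simp: line_entry_def)
  also have "{n..n+3} = {n, n+1, n+2, n+3}" by auto
  finally show ?thesis
    unfolding block_Suc by (simp add: block_def add.assoc numeral_eq_Suc)
qed

text \<open>Column 1 is the only line outside the pairs \<open>n + 1\<close>, \<open>n + 2\<close>;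
  it consists of the second column of X_0.\<close>

lemma first_column_has_sum_iff:
  assumes M: "para_tridiagonal M"
  shows "((\<lambda>l. line_entry M 1 1 l * cnj (line_entry M 1 j l)) has_sum S) {1..} \<longleftrightarrow>
     S = block M 0 0 1 * cnj (line_entry M 1 j 1) + block M 0 1 1 * cnj (line_entry M 1 j 2)"
    (is "(?f has_sum S) _ \<longleftrightarrow> _")
proof -
  have "M l 1 = 0" if "l > 2" for l
  proof -
    have "M (2*1+1) (2*1-1) = 0"
      using M unfolding para_tridiagonal_def by blast
    then show ?thesis
      using M that unfolding para_tridiagonal_def by (cases "l = 3") auto
  qed
  then have "(?f has_sum S) {1..} \<longleftrightarrow> S = sum ?f {1,2}"
    by (intro has_sum_atLeast_1_iff) (auto simp: line_entry_def)
  then show ?thesis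
    by (simp add: block_def line_entry_def numeral_eq_Suc)
qed

lemma unitary_iff_lines:
  "unitary_matrix M \<longleftrightarrow>
     (\<forall>p. \<forall>i\<ge>1. \<forall>j\<ge>1.
        ((\<lambda>l. line_entry M p i l * cnj (line_entry M p j l)) has_sum (if i = j then 1 else 0)) {1..})"
    (is "_ \<longleftrightarrow> (\<forall>p. ?L p)")
proof -
  have even: "?L p \<longleftrightarrow> is_mat_prod M (mat_adjoint M) mat_id" if "even p" for p
  proof -
    have "((\<lambda>l. line_entry M p i l * cnj (line_entry M p j l)) has_sum (if i = j then 1 else 0)) {1..}
        \<longleftrightarrow> ((\<lambda>k. M i k * mat_adjoint M k j) has_sum mat_id i j) {1..}" if "i \<ge> 1" "j \<ge> 1" for i j
      unfolding mat_id_def using that \<open>even p\<close>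
      by (intro has_sum_cong) (auto simp: line_entry_def mat_adjoint_def)
    then show ?thesis by (auto simp: is_mat_prod_def)
  qed
  have odd: "?L p \<longleftrightarrow> is_mat_prod (mat_adjoint M) M mat_id" if "odd p" for p
  proof -
    have "((\<lambda>l. line_entry M p i l * cnj (line_entry M p j l)) has_sum (if i = j then 1 else 0)) {1..}
        \<longleftrightarrow> ((\<lambda>k. mat_adjoint M j k * M k i) has_sum mat_id j i) {1..}" if "i \<ge> 1" "j \<ge> 1" for i j
      unfolding mat_id_def eq_commute[of j i] using that \<open>odd p\<close>
      by (intro has_sum_cong) (auto simp: line_entry_def mat_adjoint_def)
    then show ?thesis by (auto simp: is_mat_prod_def)
  qed
  show ?thesis
    unfolding unitary_matrix_def using even odd by (metis even_zero odd_one)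
qed

lemma has_sum_line_swap:
  "((\<lambda>l. line_entry M p i l * cnj (line_entry M p j l)) has_sum (if i = j then 1 else 0)) {1..}
   \<longleftrightarrow> ((\<lambda>l. line_entry M p j l * cnj (line_entry M p i l)) has_sum (if j = i then 1 else 0)) {1..}"
proof -
  have "((\<lambda>l. line_entry M p i l * cnj (line_entry M p j l)) has_sum (if i = j then 1 else 0)) {1..}
    \<longleftrightarrow> ((\<lambda>l. cnj (line_entry M p i l * cnj (line_entry M p j l))) has_sum cnj (if i = j then 1 else 0)) {1..}"
    by (rule has_sum_cnj_iff[symmetric])
  then show ?thesis by (simp add: mult.commute eq_commute if_distrib cong: if_cong)
qed

text \<open>Products within a pair of lines give the diagonal relation. Consecutive pairs of the
  same kind overlap in two positions, giving the off-diagonal one; pairs further apart have disjoint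
  supports. Column 1 supplies the initial condition and the off-diagonal relation for
  \<open>n = 0\<close>.\<close>

lemma unitary_para_tridiagonal_iff_blocks:
  assumes M: "para_tridiagonal M"
  shows "unitary_matrix M \<longleftrightarrow>
    block M 0 0 1 * cnj (block M 0 0 1) + block M 0 1 1 * cnj (block M 0 1 1) = 1 \<and>
    (\<forall>n. \<forall>s<2. \<forall>t<2.
       block M n s 0 * cnj (block M n t 0) + block M n s 1 * cnj (block M n t 1)
       + block M (Suc n) 0 s * cnj (block M (Suc n) 0 t)
       + block M (Suc n) 1 s * cnj (block M (Suc n) 1 t) = (if s = t then 1 else 0)) \<and>
    (\<forall>n. \<forall>s<2. \<forall>t<2.
       block M n 0 s * cnj (block M (Suc n) t 0) + block M n 1 s * cnj (block M (Suc n) t 1) = 0)"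
    (is "_ \<longleftrightarrow> ?init \<and> ?diag \<and> ?off")
proof -
  let ?P = "\<lambda>p i j. ((\<lambda>l. line_entry M p i l * cnj (line_entry M p j l))
              has_sum (if i = j then 1 else 0)) {1..}"
  have block0: "block M 0 s 0 = 0" for s
    by (simp add: block_def line_entry_def)
  have first: "?P 1 1 1 \<longleftrightarrow> ?init"
    unfolding first_column_has_sum_iff[OF M]
    by (auto simp: block_def line_entry_def numeral_eq_Suc)
  have diag: "?P n (n + 1 + s) (n + 1 + t) \<longleftrightarrow>
       block M n s 0 * cnj (block M n t 0) + block M n s 1 * cnj (block M n t 1)
       + block M (Suc n) 0 s * cnj (block M (Suc n) 0 t)
       + block M (Suc n) 1 s * cnj (block M (Suc n) 1 t) = (if s = t then 1 else 0)"
    if "s < 2" "t < 2" for n s t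
    unfolding line_has_sum_iff[OF M that(1)]
    unfolding block_Suc by (auto simp: block_def add.assoc numeral_eq_Suc)
  have off: "?P n (n + 1 + s) (n + 3 + t) \<longleftrightarrow>
       block M (Suc n) 0 s * cnj (block M (Suc (Suc n)) t 0)
       + block M (Suc n) 1 s * cnj (block M (Suc (Suc n)) t 1) = 0"
    if "s < 2" "t < 2" for n s t
  proof -
    have z: "line_entry M n (n + 3 + t) l = 0" if "l < n + 2" for l
    proof -
      have "n + 2 + 1 + t = n + 3 + t" "even (n + 2) = even n" by simp_all
      then show ?thesis
        using para_tridiagonal_line_eq_0[OF M \<open>t < 2\<close>, of l "n+2"] that
        unfolding line_entry_def by metis
    qed
    have e: "block M (Suc (Suc n)) t u = line_entry M n (n + 3 + t) (n + 2 + u)" for u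
    proof -
      have "Suc (Suc n) + 1 + t = n + 3 + t" "Suc (Suc n) + u = n + 2 + u" by simp_all
      then show ?thesis
unfolding block_def line_entry_def by (simp only: even_Suc not_not)
    qed
    show ?thesis
      unfolding line_has_sum_iff[OF M that(1)] e using that z[of n] z[of "n + 1"]
      by (auto simp: eq_commute[of 0] add.assoc numeral_3_eq_3)
  qed
  have first_off: "?P 1 1 (2 + t) \<longleftrightarrow>
       block M 0 0 1 * cnj (block M 1 t 0) + block M 0 1 1 * cnj (block M 1 t 1) = 0" for t
    unfolding first_column_has_sum_iff[OF M]
    by (auto simp: block_def line_entry_def numeral_eq_Suc)
  show ?thesis
  proof
    assume "unitary_matrix M"
    then have U: "?P p i j" if "i \<ge> 1" "j \<ge> 1" for p i j
      using that unfolding unitary_iff_lines by blast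
    have ?diag
      by (intro allI impI iffD1[OF diag] U) auto
    moreover have ?init
      by (intro iffD1[OF first] U) auto
    moreover have "block M n 0 s * cnj (block M (Suc n) t 0) + block M n 1 s * cnj (block M (Suc n) t 1) = 0"
      if "s < 2" "t < 2" for n s t
    proof (cases n)
      case 0
      then show ?thesis
        using first_off[of t] U[of 1 "2 + t" 1] block0 that by (auto simp: less_2_cases_iff)
    next
      case (Suc m)
      show ?thesis
        unfolding Suc by (intro iffD1[OF off] U that) auto
    qed
    ultimately show "?init \<and> ?diag \<and> ?off" by blast
  next
    assume R: "?init \<and> ?diag \<and> ?off"
    have pair: "?P n (n + 1 + s) j" if s: "s < 2" and j: "j \<ge> n + 1" for n s j
    proof -
      consider t where "t < 2" "j = n + 1 + t" | t where "t < 2" "j = n + 3 + t" | "j \<ge> n + 5"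
      proof -
        have "j - (n+1) < 2 \<and> j = n + 1 + (j - (n+1)) \<or> j - (n+3) < 2 \<and> j = n + 3 + (j - (n+3)) \<or> j \<ge> n + 5"
          using j by linarith
        then show thesis using that by blast
      qed
      then show ?thesis
      proof cases
        case (1 t)
        then show ?thesis using diag[OF s, of t n] R s by simp
      next
        case (2 t)
        then show ?thesis using off[OF s, of t n] R s by simp
      next
        case 3
        \<comment> \<open>\<open>m\<close> is the index of the pair containing line
          \<open>j\<close>, of the same parity as \<open>n\<close>.\<close>
        define m t where "m = n + 2 * ((j - (n+1)) div 2)" and "t = (j - (n+1)) mod 2"
        have jm: "j = m + 1 + t" "t < 2" "even m = even n" "m \<ge> n + 4"
          using 3 by (auto simp: m_def t_def) 
        have "line_entry M n j l = 0" if "l < n + 4" for l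
          using para_tridiagonal_line_eq_0[OF M jm(2), of l m] that jm by (auto simp: line_entry_def)
        then show ?thesis
          unfolding line_has_sum_iff[OF M s] using 3 s by auto
      qed
    qed
    have firstP: "?P 1 1 j" if j: "j \<ge> 1" for j
    proof -
      consider "j = 1" | t where "t < 2" "j = 2 + t" | "j \<ge> 4"
      proof -
        have "j = 1 \<or> j - 2 < 2 \<and> j = 2 + (j - 2) \<or> j \<ge> 4"
          using j by linarith
        then show thesis using that by blast
      qed
      then show ?thesis
      proof cases
        case 1
        then show ?thesis using first R by simp
      next
        case (2 t)
        then show ?thesis using first_off[of t] R by simp
      next
        case 3
        define m t where "m = 1 + 2 * ((j - 2) div 2)" and "t = (j - 2) mod 2"
        have jm: "j = m + 1 + t" "t < 2" "odd m" "m \<ge> 3"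
          using 3 by (auto simp: m_def t_def) 
        have "line_entry M 1 j l = 0" if "l < 3" for l
          using para_tridiagonal_line_eq_0[OF M jm(2), of l m] that jm by (auto simp: line_entry_def)
        then show ?thesis
          unfolding first_column_has_sum_iff[OF M] using 3 by auto
      qed
    qed
    have le: "?P p i j" if "i \<ge> 1" "i \<le> j" for p i j
    proof -
      have par: "?P p i j \<longleftrightarrow> ?P q i j" if "even p = even q" for q
        unfolding line_entry_def that by (rule refl)
      show ?thesis
      proof (cases "odd p \<and> i = 1")
        case True
        then show ?thesis using par[of 1] firstP that by simp
      next
        case False
        \<comment> \<open>\<open>r\<close> is the first line that belongs to a pair: row 1, but
          column 2.\<close>
        define r where "r = (if even p then 1 else 2 :: nat)"
        define n s where "n = r - 1 + 2 * ((i - r) div 2)" and "s = (i - r) mod 2"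
        have "i \<ge> r" using False that by (auto simp: r_def)
        then have "i = n + 1 + s" "s < 2" "even p = even n"
          by (auto simp: n_def s_def r_def)
        then show ?thesis using par[of n] pair[of s n j] that by simp
      qed
    qed
    have "?P p i j" if "i \<ge> 1" "j \<ge> 1" for p i j
      using le[of i j p] le[of j i p] has_sum_line_swap[of M p i j] that by (cases "i \<le> j") auto
    then show "unitary_matrix M" unfolding unitary_iff_lines by blast
  qed
qed

text \<open>The blocks tile the staircase: a row meets X_n and the transpose of X_{n+1} for an even
  \<open>n\<close>, and vanishes elsewhere.\<close>

lemma para_tridiagonal_eqI:
  assumes M: "para_tridiagonal M" and N: "para_tridiagonal N"
    and eq: "\<And>n s t. s < 2 \<Longrightarrow> t < 2 \<Longrightarrow> block M n s t = block N n s t"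
  shows "mat_eq M N"
  unfolding mat_eq_def
proof (intro allI impI)
  fix i j :: nat
  assume i: "1 \<le> i" and j: "1 \<le> j"
  define n s where "n = 2 * ((i - 1) div 2)" and "s = (i - 1) mod 2"
  have n: "i = n + 1 + s" "s < 2" "even n"
    using i by (auto simp: n_def s_def)
  have line: "line_entry A n i j = A i j" for A
    using i j n by (simp add: line_entry_def)
  consider t where "t < 2" "j = n + t" | t where "t < 2" "j = n + 2 + t" | "j < n \<or> n + 3 < j"
  proof -
    have "j - n < 2 \<and> j = n + (j - n) \<or> j - (n+2) < 2 \<and> j = n + 2 + (j - (n+2)) \<or> j < n \<or> n + 3 < j"
      by linarith
    then show thesis using that by blast
  qed
  then show "M i j = N i j"
  proof cases
    case (1 t)
    then show ?thesis using eq[of s t n] n line by (simp add: block_def)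
  next
    case (2 t)
    then show ?thesis using eq[of t s "Suc n"] n line unfolding block_Suc by simp
  next
    case 3
    then show ?thesis
      using para_tridiagonal_line_eq_0[OF M n(2) 3] para_tridiagonal_line_eq_0[OF N n(2) 3]
      by (metis line n(1))
  qed
qed

section \<open>The blocks of C(a, b) and its unitarity\<close>

lemma para_tridiagonal_C_matrix: "para_tridiagonal (C_matrix a b)"
  unfolding para_tridiagonal_def
proof (intro conjI allI impI)
  fix i j :: nat
  assume "1 \<le> i" "1 \<le> j" and *: "2 < \<bar>int i - int j\<bar>"
  define k where "k = (i - 1) div 2"
  have "i = 2*k+1 \<or> i = 2*k+2" using \<open>1 \<le> i\<close> by (auto simp: k_def)
  with * show "C_matrix a b i j = 0"
    unfolding C_matrix_def Let_def k_def[symmetric] by auto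
next
  fix k :: nat
  assume k: "1 \<le> k"
  have "(2*k - 1) div 2 = k - 1" using k by linarith
  then show "C_matrix a b (2*k) (2*k+2) = 0"
    unfolding C_matrix_def Let_def using k by auto
  show "C_matrix a b (2*k+1) (2*k-1) = 0"
    unfolding C_matrix_def Let_def using k by auto
qed

text \<open>Taking \<open>b 0 = 0\<close> encodes the missing column 0, so the rank-one formula also
  covers X_0.\<close>

lemma block_C_matrix:
  assumes "s < 2" "t < 2" "b 0 = 0" "a 0 = 1"
  shows "block (C_matrix a b) n s t =
    (if s = 0 then - a (Suc n) else b (Suc n)) * cnj (if t = 0 then b n else a n)"
proof -
  have a: "a(0 := 1) = a" using assms by auto
  show ?thesis
  proof (cases "even n")
    case True
    then obtain k where "n = 2 * k" by blast
    then show ?thesis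
      using assms by (auto simp: block_def line_entry_def C_matrix_def a Let_def less_2_cases_iff mult.commute)
  next
    case False
    then obtain k where "n = 2 * k + 1" by (elim oddE)
    then show ?thesis
      using assms by (auto simp: block_def line_entry_def C_matrix_def a Let_def less_2_cases_iff mult.commute)
  qed
qed

lemma mat_eq_block: "mat_eq M N \<Longrightarrow> block M = block N"
  by (intro ext) (auto simp: mat_eq_def block_def line_entry_def)

lemma C_matrix_normalize: "mat_eq (C_matrix a b) (C_matrix (a(0 := 1)) (b(0 := 0)))"
  unfolding mat_eq_def C_matrix_def Let_def by auto

text \<open>The two Gram terms of the diagonal relation are projections onto complementary unit
  vectors, built from the same pair of index \<open>Suc n\<close>. Off the diagonal the two products
  cancel.\<close>

lemma C_matrix_unitary:
  assumes M: "para_tridiagonal M" and eq: "mat_eq M (C_matrix a b)"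
    and u: "\<And>n. n \<ge> 1 \<Longrightarrow> a n * cnj (a n) + b n * cnj (b n) = 1"
  shows "unitary_matrix M"
proof -
  define \<alpha> \<beta> where "\<alpha> = a(0 := 1)" and "\<beta> = b(0 := 0)"
  have B: "block M n s t = (if s = 0 then - \<alpha> (Suc n) else \<beta> (Suc n)) * cnj (if t = 0 then \<beta> n else \<alpha> n)"
    if "s < 2" "t < 2" for n s t
    using block_C_matrix[OF that, of \<beta> \<alpha> n] mat_eq_block[OF eq] mat_eq_block[OF C_matrix_normalize, of a b]
    by (simp add: \<alpha>_def \<beta>_def)
  have U: "\<alpha> n * cnj (\<alpha> n) + \<beta> n * cnj (\<beta> n) = 1" for n
    using u[of n] by (auto simp: \<alpha>_def \<beta>_def)
  show ?thesis
    unfolding unitary_para_tridiagonal_iff_blocks[OF M]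
  proof (intro conjI allI impI)
    show "block M 0 0 1 * cnj (block M 0 0 1) + block M 0 1 1 * cnj (block M 0 1 1) = 1"
      using U[of "Suc 0"] by (simp add: B) (simp add: \<alpha>_def)
  next
    fix n s t :: nat assume st: "s < 2" "t < 2"
    define p q where "p = (if s = 0 then - \<alpha> (Suc n) else \<beta> (Suc n))"
      and "q = (if t = 0 then - \<alpha> (Suc n) else \<beta> (Suc n))"
    define v w where "v = (if s = 0 then \<beta> (Suc n) else \<alpha> (Suc n))"
      and "w = (if t = 0 then \<beta> (Suc n) else \<alpha> (Suc n))"
    have "block M n s 0 * cnj (block M n t 0) + block M n s 1 * cnj (block M n t 1)
       + block M (Suc n) 0 s * cnj (block M (Suc n) 0 t)
       + block M (Suc n) 1 s * cnj (block M (Suc n) 1 t)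
      = p * cnj q * (\<alpha> n * cnj (\<alpha> n) + \<beta> n * cnj (\<beta> n))
        + cnj v * w * (\<alpha> (Suc (Suc n)) * cnj (\<alpha> (Suc (Suc n))) + \<beta> (Suc (Suc n)) * cnj (\<beta> (Suc (Suc n))))"
      using st by (simp add: B flip: p_def q_def v_def w_def) (simp add: algebra_simps)
    also have "\<dots> = (if s = t then 1 else 0)"
      using U[of "Suc n"] st by (auto simp: U p_def q_def v_def w_def less_2_cases_iff algebra_simps)
    finally show "block M n s 0 * cnj (block M n t 0) + block M n s 1 * cnj (block M n t 1)
       + block M (Suc n) 0 s * cnj (block M (Suc n) 0 t)
       + block M (Suc n) 1 s * cnj (block M (Suc n) 1 t) = (if s = t then 1 else 0)" .
  next
    fix n s t :: nat assume "s < 2" "t < 2"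
    then show "block M n 0 s * cnj (block M (Suc n) t 0) + block M n 1 s * cnj (block M (Suc n) t 1) = 0"
      by (simp add: B)
  qed
qed

text \<open>The Gram data force the matrix with rows (x, y) and (z, w) to annihilate (cnj a, - cnj
  b): the squared norm of the image is zero. Hence each row is a multiple of (cnj b, cnj a).\<close>

lemma rank_one_of_gram:
  fixes x y z w a b :: complex
  assumes u: "a * cnj a + b * cnj b = 1"
    and 1: "x * cnj x + z * cnj z = b * cnj b"
    and 2: "y * cnj y + w * cnj w = a * cnj a"
    and 3: "cnj x * y + cnj z * w = b * cnj a"
  shows "x = (x * b + y * a) * cnj b" "y = (x * b + y * a) * cnj a"
    "z = (z * b + w * a) * cnj b" "w = (z * b + w * a) * cnj a"
proof -
  have gram_cnj: "x * cnj y + z * cnj w = cnj b * a"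
    using arg_cong[OF 3, of cnj] by simp
  let ?p = "x * cnj a - y * cnj b" and ?q = "z * cnj a - w * cnj b"
  have "?p * cnj ?p + ?q * cnj ?q
     = a * cnj a * (x * cnj x + z * cnj z) + b * cnj b * (y * cnj y + w * cnj w)
       - cnj a * b * (x * cnj y + z * cnj w) - a * cnj b * (cnj x * y + cnj z * w)"
    by (simp add: algebra_simps)
  also have "\<dots> = 0"
    unfolding 1 2 3 gram_cnj by (simp add: algebra_simps)
  finally have "complex_of_real ((cmod ?p)\<^sup>2 + (cmod ?q)\<^sup>2) = 0"
    by (simp only: of_real_add complex_norm_square)
  then have "(cmod ?p)\<^sup>2 + (cmod ?q)\<^sup>2 = 0" by (simp only: of_real_eq_0_iff)
  then have "x * cnj a = y * cnj b" "z * cnj a = w * cnj b"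
    by (simp_all add: sum_power2_eq_zero_iff)
  then show "x = (x * b + y * a) * cnj b" "y = (x * b + y * a) * cnj a"
    "z = (z * b + w * a) * cnj b" "w = (z * b + w * a) * cnj a"
    using u by algebra+
qed

text \<open>The pair is (a_n, b_n). Applying the rank-one block X_n to the column (b_n, a_n) returns
  (- a_{n+1}, b_{n+1}), since |a_n|^2 + |b_n|^2 = 1.\<close>

primrec schur_pair :: "inf_matrix \<Rightarrow> nat \<Rightarrow> complex \<times> complex" where
  "schur_pair M 0 = (1, 0)"
| "schur_pair M (Suc n) =
     (- (block M n 0 0 * snd (schur_pair M n) + block M n 0 1 * fst (schur_pair M n)),
      block M n 1 0 * snd (schur_pair M n) + block M n 1 1 * fst (schur_pair M n))"

lemma unitary_para_tridiagonal_imp_C_matrix: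
  assumes M: "para_tridiagonal M" and U: "unitary_matrix M"
  obtains a b where "\<And>n. n \<ge> 1 \<Longrightarrow> a n * cnj (a n) + b n * cnj (b n) = 1" "mat_eq M (C_matrix a b)"
proof -
  define a b where "a n = fst (schur_pair M n)" and "b n = snd (schur_pair M n)" for n
  have a0: "a 0 = 1" and b0: "b 0 = 0" by (simp_all add: a_def b_def)
  have aS: "a (Suc n) = - (block M n 0 0 * b n + block M n 0 1 * a n)"
   and bS: "b (Suc n) = block M n 1 0 * b n + block M n 1 1 * a n" for n
    by (simp_all add: a_def b_def)
  note R = U[unfolded unitary_para_tridiagonal_iff_blocks[OF M]]
  have diag: "block M n s 0 * cnj (block M n t 0) + block M n s 1 * cnj (block M n t 1)
       + block M (Suc n) 0 s * cnj (block M (Suc n) 0 t)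
       + block M (Suc n) 1 s * cnj (block M (Suc n) 1 t) = (if s = t then 1 else 0)"
    if "s < 2" "t < 2" for n s t
    using R that by blast
  \<comment> \<open>The induction invariant: the Gram matrix of the columns of X_n is that of a
    rank-one block, as \<open>rank_one_of_gram\<close> requires.\<close>
  define gram where "gram n \<longleftrightarrow> a n * cnj (a n) + b n * cnj (b n) = 1 \<and>
     block M n 0 0 * cnj (block M n 0 0) + block M n 1 0 * cnj (block M n 1 0) = b n * cnj (b n) \<and>
     block M n 0 1 * cnj (block M n 0 1) + block M n 1 1 * cnj (block M n 1 1) = a n * cnj (a n) \<and>
     cnj (block M n 0 0) * block M n 0 1 + cnj (block M n 1 0) * block M n 1 1 = b n * cnj (a n)" for n
  have form: "block M n 0 0 = - a (Suc n) * cnj (b n)" "block M n 0 1 = - a (Suc n) * cnj (a n)"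
     "block M n 1 0 = b (Suc n) * cnj (b n)" "block M n 1 1 = b (Suc n) * cnj (a n)" if "gram n" for n
    using rank_one_of_gram[of "a n" "b n" "block M n 0 0" "block M n 1 0" "block M n 0 1" "block M n 1 1"] that
    unfolding aS bS gram_def by (simp_all only: minus_minus)
  have gram: "gram n" for n
  proof (induction n)
    case 0
    show ?case using R by (simp add: gram_def a0 b0 block_def line_entry_def)
  next
    case (Suc n)
    note f = form[OF Suc]
    have u: "a n * cnj (a n) + b n * cnj (b n) = 1"
      using Suc by (simp add: gram_def)
    let ?A = "a (Suc n)" and ?B = "b (Suc n)"
    \<comment> \<open>Compare two values of the squared Frobenius norm of X_n: 1 by the invariant,
      and a product of two squared norms by the rank-one form.\<close>
    have "(block M n 0 0 * cnj (block M n 0 0) + block M n 1 0 * cnj (block M n 1 0))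
      + (block M n 0 1 * cnj (block M n 0 1) + block M n 1 1 * cnj (block M n 1 1)) = 1"
      using Suc by (simp add: gram_def add.commute)
    also have "(block M n 0 0 * cnj (block M n 0 0) + block M n 1 0 * cnj (block M n 1 0))
      + (block M n 0 1 * cnj (block M n 0 1) + block M n 1 1 * cnj (block M n 1 1))
      = (?A * cnj ?A + ?B * cnj ?B) * (a n * cnj (a n) + b n * cnj (b n))"
      by (simp only: f) (simp add: algebra_simps)
    finally have u': "?A * cnj ?A + ?B * cnj ?B = 1" by (simp add: u)
    have row: "block M n s 0 * cnj (block M n t 0) + block M n s 1 * cnj (block M n t 1)
       = (if s = 0 then - ?A else ?B) * cnj (if t = 0 then - ?A else ?B)" if "s < 2" "t < 2" for s t
    proof -
      have "block M n s 0 * cnj (block M n t 0) + block M n s 1 * cnj (block M n t 1)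
       = (if s = 0 then - ?A else ?B) * cnj (if t = 0 then - ?A else ?B) * (a n * cnj (a n) + b n * cnj (b n))"
        using that f by (auto simp: less_2_cases_iff algebra_simps)
      then show ?thesis using u by simp
    qed
    have rows: "block M n 0 0 * cnj (block M n 0 0) + block M n 0 1 * cnj (block M n 0 1) = ?A * cnj ?A"
      "block M n 1 0 * cnj (block M n 1 0) + block M n 1 1 * cnj (block M n 1 1) = ?B * cnj ?B"
      "block M n 1 0 * cnj (block M n 0 0) + block M n 1 1 * cnj (block M n 0 1) = - (?B * cnj ?A)"
      using row[of 0 0] row[of 1 1] row[of 1 0] by simp_all
    let ?X = "block M (Suc n)"
    \<comment> \<open>The row products of X_n are now known, so the diagonal relation determines the
      column Gram matrix of X_{n+1}.\<close>
    have "?A * cnj ?A + (?X 0 0 * cnj (?X 0 0) + ?X 1 0 * cnj (?X 1 0)) = 1"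
      "?B * cnj ?B + (?X 0 1 * cnj (?X 0 1) + ?X 1 1 * cnj (?X 1 1)) = 1"
      using diag[of 0 0 n] diag[of 1 1 n] unfolding rows by (simp_all add: add.assoc)
    then have "?X 0 0 * cnj (?X 0 0) + ?X 1 0 * cnj (?X 1 0) = ?B * cnj ?B"
      "?X 0 1 * cnj (?X 0 1) + ?X 1 1 * cnj (?X 1 1) = ?A * cnj ?A"
      using u' by (metis add_left_cancel add.commute)+
    moreover have "cnj (?X 0 0) * ?X 0 1 + cnj (?X 1 0) * ?X 1 1 = ?B * cnj ?A"
      using diag[of 1 0 n] unfolding rows by (simp add: algebra_simps)
    ultimately show ?case
      using u' by (simp only: gram_def)
  qed
  show thesis
  proof (rule that[of a b])
    show "a n * cnj (a n) + b n * cnj (b n) = 1" for n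
      using gram[of n] by (simp add: gram_def)
    show "mat_eq M (C_matrix a b)"
      by (rule para_tridiagonal_eqI[OF M para_tridiagonal_C_matrix])
        (auto simp: block_C_matrix[of _ _ b a, OF _ _ b0 a0] less_2_cases_iff form[OF gram, simplified])
  qed
qed

theorem theorem3p2:
  shows "(\<forall>M. para_tridiagonal M \<longrightarrow>
            (unitary_matrix M \<longleftrightarrow>
              (\<exists>a b :: nat \<Rightarrow> complex.
                 (\<forall>n\<ge>1. (cmod (a n))\<^sup>2 + (cmod (b n))\<^sup>2 = 1) \<and> mat_eq M (C_matrix a b)))) \<and>
         (\<forall>M. hessenberg M \<longrightarrow>
            (isometric_matrix M \<longleftrightarrow>
              (\<exists>a b :: nat \<Rightarrow> complex.
                 (\<forall>n\<ge>1. (cmod (a n))\<^sup>2 + (cmod (b n))\<^sup>2 = 1) \<and> mat_eq M (H_matrix a b))))"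
  unfolding unit_pair_complex
proof (intro conjI allI impI)
  fix M
  assume M: "para_tridiagonal M"
  show "unitary_matrix M \<longleftrightarrow>
      (\<exists>a b. (\<forall>n\<ge>1. a n * cnj (a n) + b n * cnj (b n) = 1) \<and> mat_eq M (C_matrix a b))"
    using C_matrix_unitary[OF M] unitary_para_tridiagonal_imp_C_matrix[OF M] by metis
next
  fix M
  assume M: "hessenberg M"
  \<comment> \<open>Isometry passes from \<open>H_matrix a b\<close> to \<open>M\<close> through the
    finite-sum criterion, which inspects only positive indices, where the two agree.\<close>
  have "isometric_matrix M" if "\<And>n. n \<ge> 1 \<Longrightarrow> a n * cnj (a n) + b n * cnj (b n) = 1"
    "mat_eq M (H_matrix a b)" for a b
    using H_matrix_isometric[OF that(1)] that(2)
    unfolding hessenberg_isometric_iff[OF M] hessenberg_isometric_iff[OF hessenberg_H_matrix]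
    by (simp add: mat_eq_def)
  then show "isometric_matrix M \<longleftrightarrow>
      (\<exists>a b. (\<forall>n\<ge>1. a n * cnj (a n) + b n * cnj (b n) = 1) \<and> mat_eq M (H_matrix a b))"
    using isometric_hessenberg_imp_H_matrix[OF M] by metis
qed

end
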